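(* Let $n>m$ and let $X,Y,b,c,x_0,Q,W,h,g,M_w$ be as described in the context. Let $v$ be a price schedule with corresponding utility $v^b(x)$. Define $$\tilde v(y)=\begin{cases}(v^b)^b(y)=\sup_{x\in\overline X}\big(b(x,y)-v^b(x)\big) & \text{if } y\in M_w \text{ for some } w\in W,\\ +\infty & \text{otherwise.}\end{cases}$$ Then $\tilde v^b(x)=v^b(x)$ and, for almost all $x$, for any $y\in\operatorname{argmax}_{y'\in\overline Y}\,(b(x,y')-v(y'))$ and any $\tilde y\in\operatorname{argmax}_{y'\in\overline Y}\,(b(x,y')-\tilde v(y'))$, we have $$v(y)-c(y)\le\tilde v(\tilde y)-c(\tilde y).$$ Furthermore, $$\tilde v(\tilde y)-c(\tilde y)=h(x,Q(\tilde y))-v^b(x)-g(Q(\tilde y))=b(x,\tilde y)-v^b(x)-c(\tilde y).$$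
   Context: $X\subset\mathbb{R}^m$ and $Y\subset\mathbb{R}^n$ are nonempty, open and bounded, $n>m$, and $b\in C^4(\overline X\times\overline Y)$. For all $x_0\in\overline X$, $y_0\in\overline Y$, the level sets of $y\mapsto D_xb(x_0,y)$ and of $x\mapsto D_yb(x,y_0)$ are connected and the $m\times n$ matrix $D^2_{xy}b(x_0,y_0)$ has full rank. $\overline X$ is $b$-convex: $D_yb(\overline X,y_0)\subseteq\mathbb{R}^n$ is convex for every $y_0\in\overline Y$. In this setting the sets $L_y(x)=\{\overline y\in\overline Y: D_xb(x,\overline y)=D_xb(x,y)\}$ are independent of $x$ and are denoted $L_y$. Fix $x_0\in X$. Let $Q(y)=D_xb(x_0,y)$ for $y\in\overline Y$ and $W=Q(\overline Y)\subseteq\mathbb{R}^m$ (the space of effective goods). The effective preference function is $h(x,w)=b(x,y)-b(x_0,y)$ for any $y\in Q^{-1}(w)$; this is well defined. With $c:\overline Y\to\mathbb{R}$ the production cost, the effective cost is $g(w)=\inf_{\{y:Q(y)=w\}}\big(c(y)-b(x_0,y)\big)$, and $M_w=\operatorname{argmin}_{\{y:Q(y)=w\}}\big(c(y)-b(x_0,y)\big)$, where it is assumed that the minimum is attained, i.e. $M_w\neq\emptyset$ for every $w\in W$. A price schedule is a function $v:\overline Y\to\mathbb{R}\cup\{+\infty\}$ and $v^b(x)=\sup_{y\in\overline Y}(b(x,y)-v(y))$, assumed finite; similarly $\tilde v^b(x)=\sup_{y\in\overline Y}(b(x,y)-\tilde v(y))$. "Almost all" is with respect to Lebesgue measure on $X$.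 *)

theory Defs
  imports "HOL-Analysis.Analysis"
begin

(* Class C^k on an open set S: all iterated partial derivatives up to order k exist and are
   continuous on S.  (For k > 0, continuity of f itself is implied by differentiability.) *)
primrec C_diff_on :: "nat \<Rightarrow> 'a::euclidean_space set \<Rightarrow> ('a \<Rightarrow> real) \<Rightarrow> bool" where
  "C_diff_on 0 S f \<longleftrightarrow> continuous_on S f"
| "C_diff_on (Suc k) S f \<longleftrightarrow>
     (\<forall>p\<in>S. f differentiable (at p)) \<and>
     (\<forall>e\<in>Basis. C_diff_on k S (\<lambda>p. frechet_derivative f (at p) e))"

(* C^k up to the boundary, on the compact set cl X x cl Y: b is C^k on an open neighbourhood of
   this set.  The values of b and of its derivatives on cl X x cl Y do not depend on the values of
   b elsewhere, because X x Y is open and dense in cl X x cl Y. *)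
definition C_diff_closure ::
  "nat \<Rightarrow> (real^'m) set \<Rightarrow> (real^'n) set \<Rightarrow> (real^'m \<Rightarrow> real^'n \<Rightarrow> real) \<Rightarrow> bool" where
  "C_diff_closure k X Y b \<longleftrightarrow>
     (\<exists>U. open U \<and> closure X \<times> closure Y \<subseteq> U \<and> C_diff_on k U (\<lambda>(x, y). b x y))"

definition gradient :: "('a::real_inner \<Rightarrow> real) \<Rightarrow> 'a \<Rightarrow> 'a" where
  "gradient f x = (THE D. GDERIV f x :> D)"

definition D_x :: "(real^'m \<Rightarrow> real^'n \<Rightarrow> real) \<Rightarrow> real^'m \<Rightarrow> real^'n \<Rightarrow> real^'m" where
  "D_x b x y = gradient (\<lambda>x'. b x' y) x"

definition D_y :: "(real^'m \<Rightarrow> real^'n \<Rightarrow> real) \<Rightarrow> real^'m \<Rightarrow> real^'n \<Rightarrow> real^'n" where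
  "D_y b x y = gradient (\<lambda>y'. b x y') y"

definition D2_xy :: "(real^'m \<Rightarrow> real^'n \<Rightarrow> real) \<Rightarrow> real^'m \<Rightarrow> real^'n \<Rightarrow> real^'n^'m" where
  "D2_xy b x y = jacobian (\<lambda>y'. D_x b x y') (at y)"

definition b_convex ::
  "(real^'m) set \<Rightarrow> (real^'n) set \<Rightarrow> (real^'m \<Rightarrow> real^'n \<Rightarrow> real) \<Rightarrow> bool" where
  "b_convex X Y b \<longleftrightarrow> (\<forall>y\<in>closure Y. convex ((\<lambda>x. D_y b x y) ` closure X))"

(* Independence of L_set Y b x y from x does not follow from b-convexity, full rank and
   connectedness alone when cl Y has an irregular boundary (a C^4 function need not be constant on
   a connected set of critical points), so it has to be assumed explicitly where needed. *)
definition L_set ::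
  "(real^'n) set \<Rightarrow> (real^'m \<Rightarrow> real^'n \<Rightarrow> real) \<Rightarrow> real^'m \<Rightarrow> real^'n \<Rightarrow> (real^'n) set" where
  "L_set Y b x y = {y' \<in> closure Y. D_x b x y' = D_x b x y}"

definition Q_map ::
  "(real^'m \<Rightarrow> real^'n \<Rightarrow> real) \<Rightarrow> real^'m \<Rightarrow> real^'n \<Rightarrow> real^'m" where
  "Q_map b x0 y = D_x b x0 y"

definition W_set ::
  "(real^'n) set \<Rightarrow> (real^'m \<Rightarrow> real^'n \<Rightarrow> real) \<Rightarrow> real^'m \<Rightarrow> (real^'m) set" where
  "W_set Y b x0 = Q_map b x0 ` closure Y"

definition Q_fiber ::
  "(real^'n) set \<Rightarrow> (real^'m \<Rightarrow> real^'n \<Rightarrow> real) \<Rightarrow> real^'m \<Rightarrow> real^'m \<Rightarrow> (real^'n) set" where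
  "Q_fiber Y b x0 w = {y \<in> closure Y. Q_map b x0 y = w}"

(* The common value of b x y - b x0 y over all y in the fiber of w. *)
definition eff_pref ::
  "(real^'n) set \<Rightarrow> (real^'m \<Rightarrow> real^'n \<Rightarrow> real) \<Rightarrow> real^'m \<Rightarrow> real^'m \<Rightarrow> real^'m \<Rightarrow> real" where
  "eff_pref Y b x0 x w = (THE r. \<forall>y\<in>Q_fiber Y b x0 w. b x y - b x0 y = r)"

definition eff_cost ::
  "(real^'n) set \<Rightarrow> (real^'m \<Rightarrow> real^'n \<Rightarrow> real) \<Rightarrow> (real^'n \<Rightarrow> real) \<Rightarrow> real^'m \<Rightarrow> real^'m \<Rightarrow> real" where
  "eff_cost Y b c x0 w = (INF y\<in>Q_fiber Y b x0 w. c y - b x0 y)"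

definition M_set ::
  "(real^'n) set \<Rightarrow> (real^'m \<Rightarrow> real^'n \<Rightarrow> real) \<Rightarrow> (real^'n \<Rightarrow> real) \<Rightarrow> real^'m \<Rightarrow> real^'m
     \<Rightarrow> (real^'n) set" where
  "M_set Y b c x0 w = {y. is_arg_min (\<lambda>y'. c y' - b x0 y') (\<lambda>y'. y' \<in> Q_fiber Y b x0 w) y}"

definition utility ::
  "(real^'n) set \<Rightarrow> (real^'m \<Rightarrow> real^'n \<Rightarrow> real) \<Rightarrow> (real^'n \<Rightarrow> ereal) \<Rightarrow> real^'m \<Rightarrow> ereal" where
  "utility Y b v x = (SUP y\<in>closure Y. ereal (b x y) - v y)"

definition utility_transform ::
  "(real^'m) set \<Rightarrow> (real^'m \<Rightarrow> real^'n \<Rightarrow> real) \<Rightarrow> (real^'m \<Rightarrow> ereal) \<Rightarrow> real^'n \<Rightarrow> ereal" where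
  "utility_transform X b u y = (SUP x\<in>closure X. ereal (b x y) - u x)"

definition optimal_goods ::
  "(real^'n) set \<Rightarrow> (real^'m \<Rightarrow> real^'n \<Rightarrow> real) \<Rightarrow> (real^'n \<Rightarrow> ereal) \<Rightarrow> real^'m \<Rightarrow> (real^'n) set" where
  "optimal_goods Y b v x = {y. is_arg_max (\<lambda>y'. ereal (b x y') - v y') (\<lambda>y'. y' \<in> closure Y) y}"

definition v_tilde ::
  "(real^'m) set \<Rightarrow> (real^'n) set \<Rightarrow> (real^'m \<Rightarrow> real^'n \<Rightarrow> real) \<Rightarrow> (real^'n \<Rightarrow> real) \<Rightarrow> real^'m
     \<Rightarrow> (real^'n \<Rightarrow> ereal) \<Rightarrow> real^'n \<Rightarrow> ereal" where
  "v_tilde X Y b c x0 v y =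
     (if \<exists>w\<in>W_set Y b x0. y \<in> M_set Y b c x0 w
      then utility_transform X b (utility Y b v) y else \<infinity>)"

end

theory Submission
  imports Defs
begin

text \<open>
  For fixed y in the closure of Y, the map F = D_y b(., y) has injective derivative on the closure K
  of X (the transpose of D^2_xy b, by symmetry of second derivatives), so its connected level sets
  are single points, and F is a homeomorphism from K onto a convex set whose inverse is pointwise
  Lipschitz. Pulling segments back through F joins any two points of K by a path along which every
  function with vanishing gradient on K is constant; hence b(x, y) - b(x0, y) depends on y only
  through Q(y). Replacing a good by a cheapest one in its Q-fibre therefore changes the price
  (v^b)^b only by the difference of b(x0, .), which gives equality of the utilities.

  At a maximizer y, D_x b(x, y) is a Frechet subgradient of v^b at x. Instead of Rademacher's theorem
  it suffices that a continuous function has two distinct Frechet subgradients only on a null set.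
  Thus for almost all x all maximizers, for either schedule, share the same D_x b(x, .), hence the
  same Q, and the one produced in the schedule with the tilde has least cost in its fibre.
\<close>

section \<open>Symmetry of second derivatives\<close>

text \<open>The mean value theorem along \<open>a\<close>, applied to the difference of
  \<open>f\<close> over the step \<open>t *\<^sub>R b\<close>, turns the second difference into a
  difference of two values of \<open>f' _ a\<close>. Both are linearised at the single point
  \<open>p\<close>, so differentiability of \<open>q \<mapsto> f' q a\<close> at \<open>p\<close> is
  enough and no continuity of second derivatives enters.\<close>

lemma second_difference_estimate:
  fixes f :: "'a::real_normed_vector \<Rightarrow> real"
  assumes "open U" "p \<in> U"
    and f: "\<And>q. q \<in> U \<Longrightarrow> (f has_derivative f' q) (at q)"
    and f'': "((\<lambda>q. f' q a) has_derivative A) (at p)"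
    and "e > 0"
  obtains d where "d > 0"
    "\<And>t. 0 < t \<Longrightarrow> t < d \<Longrightarrow>
      \<bar>f (p + t *\<^sub>R a + t *\<^sub>R b) - f (p + t *\<^sub>R a) - f (p + t *\<^sub>R b) + f p - t\<^sup>2 * A b\<bar> \<le> e * t\<^sup>2"
proof -
  \<comment> \<open>\<open>t * K\<close> bounds every displacement with coefficients in
    \<open>{0..t}\<close>; the summand 1 keeps \<open>K\<close> positive when
    \<open>a = b = 0\<close>.\<close>
  define K where "K = norm a + norm b + 1"
  have K: "K > 0" unfolding K_def by (smt (verit) norm_ge_zero)
  obtain r where r: "r > 0" "ball p r \<subseteq> U"
    using assms(1,2) openE by blast
  obtain \<delta> where \<delta>: "\<delta> > 0"
    "\<And>q. norm (q - p) < \<delta> \<Longrightarrow> norm (f' q a - f' p a - A (q - p)) \<le> e / (2 * K) * norm (q - p)"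
  proof -
    \<comment> \<open>The linearisation is used at two points, so each may cost only
      \<open>e / 2 * t\<close>.\<close>
    have "e / (2 * K) > 0" using K \<open>e > 0\<close> by simp
    then show thesis using f'' that unfolding has_derivative_at_alt by blast
  qed
  have lin: "linear A" using f'' has_derivative_linear by blast
  define d where "d = min r \<delta> / K"
  show thesis
  proof (rule that[of d])
    show "d > 0" using r \<delta> K by (simp add: d_def)
    fix t :: real assume t: "0 < t" "t < d"
    have nrm: "norm (s *\<^sub>R a + s' *\<^sub>R b) \<le> t * K" if "0 \<le> s" "s \<le> t" "0 \<le> s'" "s' \<le> t" for s s'
    proof -
      have "norm (s *\<^sub>R a + s' *\<^sub>R b) \<le> s * norm a + s' * norm b"
        using norm_triangle_ineq[of "s *\<^sub>R a" "s' *\<^sub>R b"] that by simp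
      also have "\<dots> \<le> t * norm a + t * norm b"
        using that by (intro add_mono mult_right_mono) auto
      also have "\<dots> \<le> t * K" using t by (simp add: K_def algebra_simps)
      finally show ?thesis .
    qed
    have tK: "t * K < r" "t * K < \<delta>"
      using t K by (auto simp: d_def field_simps)
    have inU: "p + s *\<^sub>R a + s' *\<^sub>R b \<in> U" if "0 \<le> s" "s \<le> t" "0 \<le> s'" "s' \<le> t" for s s'
    proof -
      have "dist p (p + (s *\<^sub>R a + s' *\<^sub>R b)) < r"
        using nrm[OF that] tK(1) by (simp add: dist_norm norm_minus_commute add.commute)
      then show ?thesis using r by (auto simp: add.assoc)
    qed
    have est: "\<bar>f' (p + s *\<^sub>R a + s' *\<^sub>R b) a - f' p a - A (s *\<^sub>R a + s' *\<^sub>R b)\<bar> \<le> e / 2 * t"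
      if "0 \<le> s" "s \<le> t" "0 \<le> s'" "s' \<le> t" for s s'
    proof -
      have *: "p + s *\<^sub>R a + s' *\<^sub>R b - p = s *\<^sub>R a + s' *\<^sub>R b" by simp
      have "\<bar>f' (p + s *\<^sub>R a + s' *\<^sub>R b) a - f' p a - A (s *\<^sub>R a + s' *\<^sub>R b)\<bar>
          \<le> e / (2 * K) * norm (s *\<^sub>R a + s' *\<^sub>R b)"
        using \<delta>(2)[of "p + s *\<^sub>R a + s' *\<^sub>R b"] nrm[OF that] tK unfolding * by simp
      also have "\<dots> \<le> e / (2 * K) * (t * K)"
        using nrm[OF that] K \<open>e > 0\<close> by (intro mult_left_mono) auto
      also have "\<dots> = e / 2 * t" using K by simp
      finally show ?thesis .
    qed
    define \<phi> where "\<phi> s = f (p + s *\<^sub>R a + t *\<^sub>R b) - f (p + s *\<^sub>R a)" for s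
    have der: "((\<lambda>s. f (p + s *\<^sub>R a + s' *\<^sub>R b)) has_real_derivative f' (p + s *\<^sub>R a + s' *\<^sub>R b) a) (at s)"
      if "0 \<le> s" "s \<le> t" "0 \<le> s'" "s' \<le> t" for s s'
    proof -
      have g: "((\<lambda>s. p + s *\<^sub>R a + s' *\<^sub>R b) has_derivative (\<lambda>h. h *\<^sub>R a)) (at s)"
        by (auto intro!: derivative_eq_intros)
      have "((\<lambda>s. f (p + s *\<^sub>R a + s' *\<^sub>R b)) has_derivative (\<lambda>h. f' (p + s *\<^sub>R a + s' *\<^sub>R b) (h *\<^sub>R a))) (at s)"
        using has_derivative_compose[OF g f[OF inU[OF that]]] .
      moreover have "f' (p + s *\<^sub>R a + s' *\<^sub>R b) (h *\<^sub>R a) = f' (p + s *\<^sub>R a + s' *\<^sub>R b) a * h" for h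
        using has_derivative_linear[OF f[OF inU[OF that]]] by (simp add: linear_cmul mult.commute)
      ultimately show ?thesis by (simp add: has_field_derivative_def)
    qed
    have "(\<phi> has_real_derivative f' (p + s *\<^sub>R a + t *\<^sub>R b) a - f' (p + s *\<^sub>R a + 0 *\<^sub>R b) a) (at s)"
      if "0 \<le> s" "s \<le> t" for s
      using DERIV_diff[OF der[of s t] der[of s 0]] that t by (simp add: \<phi>_def[abs_def])
    from MVT2[OF t(1) this] obtain \<xi> where \<xi>: "0 < \<xi>" "\<xi> < t" and
      eq: "\<phi> t - \<phi> 0 = t * (f' (p + \<xi> *\<^sub>R a + t *\<^sub>R b) a - f' (p + \<xi> *\<^sub>R a + 0 *\<^sub>R b) a)"
      by auto
    \<comment> \<open>The unknown \<xi> drops out: its contribution to the two linearisations is the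
      same.\<close>
    have A: "A (\<xi> *\<^sub>R a + t *\<^sub>R b) = A (\<xi> *\<^sub>R a + 0 *\<^sub>R b) + t * A b"
      using lin by (simp add: linear_add linear_cmul)
    have "\<bar>f' (p + \<xi> *\<^sub>R a + t *\<^sub>R b) a - f' (p + \<xi> *\<^sub>R a + 0 *\<^sub>R b) a - t * A b\<bar> \<le> e * t"
      using est[of \<xi> t] est[of \<xi> 0] \<xi> t unfolding A abs_le_iff by (auto simp: field_simps)
    moreover have "\<phi> t - \<phi> 0 - t\<^sup>2 * A b
        = t * (f' (p + \<xi> *\<^sub>R a + t *\<^sub>R b) a - f' (p + \<xi> *\<^sub>R a + 0 *\<^sub>R b) a - t * A b)"
      unfolding eq by (simp only: power2_eq_square right_diff_distrib mult.assoc)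
    ultimately have "\<bar>\<phi> t - \<phi> 0 - t\<^sup>2 * A b\<bar> \<le> t * (e * t)"
      using t(1) by (simp only: abs_mult abs_of_pos mult_left_mono less_imp_le)
    also have "t * (e * t) = e * t\<^sup>2" by (simp add: power2_eq_square)
    finally show "\<bar>f (p + t *\<^sub>R a + t *\<^sub>R b) - f (p + t *\<^sub>R a) - f (p + t *\<^sub>R b) + f p - t\<^sup>2 * A b\<bar> \<le> e * t\<^sup>2"
      by (simp add: \<phi>_def)
  qed
qed

text \<open>The second difference is symmetric in \<open>a\<close> and \<open>b\<close>, and after
  division by \<open>t\<^sup>2\<close> it approximates both \<open>A b\<close> and
  \<open>B a\<close>.\<close>

lemma second_derivative_symmetric:
  fixes f :: "'a::real_normed_vector \<Rightarrow> real"
  assumes U: "open U" "p \<in> U"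
    and f: "\<And>q. q \<in> U \<Longrightarrow> (f has_derivative f' q) (at q)"
    and A: "((\<lambda>q. f' q a) has_derivative A) (at p)"
    and B: "((\<lambda>q. f' q b) has_derivative B) (at p)"
  shows "A b = B a"
proof (rule ccontr)
  assume "A b \<noteq> B a"
  \<comment> \<open>The two estimates together allow a gap of \<open>2 * e\<close>, below the actual
    gap \<open>3 * e\<close>.\<close>
  define e where "e = \<bar>A b - B a\<bar> / 3"
  have e: "e > 0" using \<open>A b \<noteq> B a\<close> by (simp add: e_def)
  obtain d1 where d1: "d1 > 0" "\<And>t. 0 < t \<Longrightarrow> t < d1 \<Longrightarrow>
      \<bar>f (p + t *\<^sub>R a + t *\<^sub>R b) - f (p + t *\<^sub>R a) - f (p + t *\<^sub>R b) + f p - t\<^sup>2 * A b\<bar> \<le> e * t\<^sup>2"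
    using second_difference_estimate[OF U f A e] by blast
  obtain d2 where d2: "d2 > 0" "\<And>t. 0 < t \<Longrightarrow> t < d2 \<Longrightarrow>
      \<bar>f (p + t *\<^sub>R b + t *\<^sub>R a) - f (p + t *\<^sub>R b) - f (p + t *\<^sub>R a) + f p - t\<^sup>2 * B a\<bar> \<le> e * t\<^sup>2"
    using second_difference_estimate[OF U f B e] by blast
  obtain t where t: "0 < t" "t < d1" "t < d2"
    using d1 d2 by (meson dense less_trans min_less_iff_conj)
  have comm: "p + t *\<^sub>R b + t *\<^sub>R a = p + t *\<^sub>R a + t *\<^sub>R b" by simp
  have "\<bar>t\<^sup>2 * A b - t\<^sup>2 * B a\<bar> \<le> 2 * (e * t\<^sup>2)"
    using d1(2)[OF t(1,2)] d2(2)[OF t(1,3)] unfolding comm abs_le_iff by linarith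
  then have "\<bar>t\<^sup>2 * (A b - B a)\<bar> \<le> t\<^sup>2 * (2 * e)"
    by (simp add: algebra_simps)
  then have "\<bar>A b - B a\<bar> \<le> 2 * e" using t by (simp add: abs_mult)
  then show False using e by (simp add: e_def)
qed

section \<open>Functions with vanishing derivative on a set with convex image\<close>

text \<open>The set \<open>K\<close> need not have rectifiable paths a priori, and a smooth function need not be constant
  on a connected set of critical points; the paths come from the convex image.\<close>
lemma constant_if_zero_derivative_reparametrized:
  fixes F :: "'a::euclidean_space \<Rightarrow> 'b::euclidean_space" and f :: "'a \<Rightarrow> 'c::real_normed_vector"
  assumes K: "compact K"
    and F: "\<And>x. x \<in> K \<Longrightarrow> (F has_derivative F' x) (at x within K)"
    and inj: "\<And>x. x \<in> K \<Longrightarrow> inj (F' x)"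
    and conn: "\<And>q. connected {x \<in> K. F x = q}"
    and conv: "convex (F ` K)"
    and f: "\<And>x. x \<in> K \<Longrightarrow> (f has_derivative (\<lambda>_. 0)) (at x within K)"
    and xz: "x \<in> K" "z \<in> K"
  shows "f x = f z"
proof -
  \<comment> \<open>An injective linear map is bounded below; half of its bound absorbs the
    linearisation error. This makes points of a fibre isolated and the inverse of \<open>F\<close>
    pointwise Lipschitz.\<close>
  have lower: "\<exists>B>0. \<exists>d>0. \<forall>y\<in>K. norm (y - x) < d \<longrightarrow> B * norm (y - x) \<le> norm (F y - F x)"
    if x: "x \<in> K" for x
  proof -
    have "linear (F' x)" using F[OF x] has_derivative_linear by blast
    then obtain B where B: "B > 0" "\<And>h. B * norm h \<le> norm (F' x h)"
      using linear_inj_bounded_below_pos[OF _ inj[OF x]] by blast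
    obtain d where d: "d > 0"
      "\<And>y. y \<in> K \<Longrightarrow> norm (y - x) < d \<Longrightarrow> norm (F y - F x - F' x (y - x)) \<le> B / 2 * norm (y - x)"
      using F[OF x] B(1) unfolding has_derivative_within_alt by (meson half_gt_zero)
    have "B / 2 * norm (y - x) \<le> norm (F y - F x)" if "y \<in> K" "norm (y - x) < d" for y
      using d(2)[OF that] B(2)[of "y - x"] norm_triangle_ineq2[of "F' x (y - x)" "F y - F x"]
      by (simp add: norm_minus_commute)
    then show ?thesis using B(1) d(1) half_gt_zero by blast
  qed
  have contF: "continuous_on K F"
    using F by (meson continuous_on_eq_continuous_within has_derivative_continuous)
  have injF: "inj_on F K"
  proof (rule inj_onI, rule ccontr)
    fix x y assume xy: "x \<in> K" "y \<in> K" "F x = F y" "x \<noteq> y"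
    let ?S = "{x' \<in> K. F x' = F x}"
    have "?S \<noteq> {w}" for w
    proof -
      have "x \<in> ?S" "y \<in> ?S" using xy by auto
      then show ?thesis using xy(4) by (metis (no_types, lifting) singletonD)
    qed
    \<comment> \<open>A connected set with more than one point has no isolated points, whereas
      \<open>lower\<close> isolates \<open>x\<close> in its fibre.\<close>
    then have "x islimpt ?S"
      using xy by (intro connected_imp_perfect[OF conn]) auto
    moreover obtain B d where "B > 0" "d > 0" "\<forall>y\<in>K. norm (y - x) < d \<longrightarrow> B * norm (y - x) \<le> norm (F y - F x)"
      using lower[OF xy(1)] by blast
    ultimately obtain y' where y': "y' \<in> K" "F y' = F x" "y' \<noteq> x" "B * norm (y' - x) \<le> norm (F y' - F x)"
      unfolding islimpt_approachable dist_norm by (metis (mono_tags, lifting) mem_Collect_eq)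
    then have "B * norm (y' - x) \<le> 0" "norm (y' - x) > 0" by auto
    then show False using \<open>B > 0\<close> by (simp add: mult_le_0_iff)
  qed
  define g where "g = inv_into K F"
  have gF: "g (F y) = y" if "y \<in> K" for y using injF that by (simp add: g_def)
  have contg: "continuous_on (F ` K) g"
    using continuous_on_inv[OF contF K] gF by blast
  define l where "l t = (1 - t) *\<^sub>R F x + t *\<^sub>R F z" for t
  have l: "l t \<in> F ` K" if "t \<in> {0..1}" for t
    using that xz conv unfolding l_def by (auto intro!: convexD_alt)
  define \<gamma> where "\<gamma> t = g (l t)" for t
  have \<gamma>K: "\<gamma> t \<in> K" and F\<gamma>: "F (\<gamma> t) = l t" if "t \<in> {0..1}" for t
    using l[OF that] gF by (auto simp: \<gamma>_def)
  have cont\<gamma>: "continuous_on {0..1} \<gamma>"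
    unfolding \<gamma>_def
    by (rule continuous_on_compose2[OF contg])
       (auto simp: l_def intro!: continuous_intros l[unfolded l_def])
  define L where "L = norm (F z - F x)"
  have dl: "norm (l s - l t) = \<bar>s - t\<bar> * L" for s t
  proof -
    have "l s - l t = (s - t) *\<^sub>R (F z - F x)" by (simp add: l_def algebra_simps)
    then show ?thesis by (simp add: L_def)
  qed
  have "((\<lambda>t. f (\<gamma> t)) has_derivative (\<lambda>_. 0)) (at t within {0..1})" if t: "t \<in> {0..1}" for t
    unfolding has_derivative_within_alt
  proof (intro conjI allI impI)
    show "bounded_linear (\<lambda>_::real. 0::'c)" by simp
    fix e :: real assume e: "e > 0"
    obtain B d where B: "B > 0" and d: "d > 0"
      and low: "\<And>y. y \<in> K \<Longrightarrow> norm (y - \<gamma> t) < d \<Longrightarrow> B * norm (y - \<gamma> t) \<le> norm (F y - F (\<gamma> t))"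
      using lower[OF \<gamma>K[OF t]] by blast
    \<comment> \<open>Near \<open>t\<close> the lift satisfies \<open>norm (\<gamma> s - \<gamma> t)
      \<le> norm (s - t) * (L + 1) / B\<close>, and \<open>e'\<close> turns this factor into
      \<open>e\<close>. Using \<open>L + 1\<close> makes the quotient safe also when
      \<open>L = 0\<close>.\<close>
    define e' where "e' = e * B / (L + 1)"
    have L: "L \<ge> 0" by (simp add: L_def)
    have e': "e' > 0" using e B L by (simp add: e'_def)
    obtain d' where d': "d' > 0" and up: "\<And>y. y \<in> K \<Longrightarrow> norm (y - \<gamma> t) < d' \<Longrightarrow>
        norm (f y - f (\<gamma> t)) \<le> e' * norm (y - \<gamma> t)"
      using f[OF \<gamma>K[OF t]] e' unfolding has_derivative_within_alt by (auto simp del: norm_minus_commute)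
    obtain \<delta> where \<delta>: "\<delta> > 0" "\<And>s. s \<in> {0..1} \<Longrightarrow> dist s t < \<delta> \<Longrightarrow> dist (\<gamma> s) (\<gamma> t) < min d d'"
      using cont\<gamma> t d d' unfolding continuous_on_iff by (metis min_less_iff_conj)
    show "\<exists>\<delta>>0. \<forall>s\<in>{0..1}. norm (s - t) < \<delta> \<longrightarrow> norm (f (\<gamma> s) - f (\<gamma> t) - 0) \<le> e * norm (s - t)"
    proof (intro exI[of _ \<delta>] conjI ballI impI \<delta>)
      fix s :: real assume s: "s \<in> {0..1}" "norm (s - t) < \<delta>"
      have close: "norm (\<gamma> s - \<gamma> t) < min d d'" using \<delta>(2)[OF s(1)] s(2) by (simp add: dist_norm)
      have "B * norm (\<gamma> s - \<gamma> t) \<le> norm (s - t) * L"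
        using low[OF \<gamma>K[OF s(1)]] close dl[of s t] by (simp add: F\<gamma>[OF s(1)] F\<gamma>[OF t])
      also have "\<dots> \<le> norm (s - t) * (L + 1)" by (simp add: mult_left_mono)
      finally have *: "norm (\<gamma> s - \<gamma> t) \<le> norm (s - t) * (L + 1) / B"
        using B by (simp add: field_simps)
      have "norm (f (\<gamma> s) - f (\<gamma> t)) \<le> e' * norm (\<gamma> s - \<gamma> t)"
        using up[OF \<gamma>K[OF s(1)]] close by simp
      also have "\<dots> \<le> e' * (norm (s - t) * (L + 1) / B)"
        using * e' by (intro mult_left_mono) auto
      also have "\<dots> = e * norm (s - t)" using B L by (simp add: e'_def)
      finally show "norm (f (\<gamma> s) - f (\<gamma> t) - 0) \<le> e * norm (s - t)" by simp
    qed
  qed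
  then obtain k where "\<And>t. t \<in> {0..1} \<Longrightarrow> f (\<gamma> t) = k"
    using has_derivative_zero_constant[of "{0..1::real}" "\<lambda>t. f (\<gamma> t)"] by auto
  then have "f (\<gamma> 0) = f (\<gamma> 1)" by simp
  then show ?thesis using gF xz by (simp add: \<gamma>_def l_def)
qed

section \<open>Points with several Frechet subgradients\<close>

text \<open>The shifts \<open>d / Suc k\<close> differ pairwise by amounts in \<open>(0, d]\<close>,
  so the corresponding translates of \<open>E\<close> are disjoint. Infinitely many sets of equal
  measure fit into one ball only if that measure is zero.\<close>

lemma negligible_if_disjoint_translates:
  fixes E :: "'a::euclidean_space set"
  assumes meas: "E \<in> lmeasurable" and bdd: "bounded E" and d: "d > 0"
    and sep: "\<And>x s. x \<in> E \<Longrightarrow> 0 < s \<Longrightarrow> s \<le> d \<Longrightarrow> x + s *\<^sub>R e \<notin> E"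
  shows "negligible E"
proof -
  define T where "T k = (+) ((d / real (Suc k)) *\<^sub>R e) ` E" for k
  have T: "T k \<in> lmeasurable" "measure lebesgue (T k) = measure lebesgue E" for k
    using meas unfolding T_def by (auto simp: measurable_translation measure_translation)
  have disj: "disjnt (T j) (T k)" if "j < k" for j k
  proof (rule ccontr)
    assume "\<not> disjnt (T j) (T k)"
    then obtain x y where xy: "x \<in> E" "y \<in> E" "(d / real (Suc j)) *\<^sub>R e + x = (d / real (Suc k)) *\<^sub>R e + y"
      by (auto simp: T_def disjnt_iff)
    define s where "s = d / real (Suc j) - d / real (Suc k)"
    have "y = x + s *\<^sub>R e" using xy(3) by (simp add: s_def algebra_simps)
    moreover have "0 < s" using d that by (simp add: s_def divide_strict_left_mono)
    moreover have "s \<le> d"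
    proof -
      have "d / real (Suc j) \<le> d" using d by (simp add: divide_le_eq)
      moreover have "0 \<le> d / real (Suc k)" using d by simp
      ultimately show ?thesis unfolding s_def by linarith
    qed
    ultimately show False using sep xy by blast
  qed
  obtain R where R: "\<And>x. x \<in> E \<Longrightarrow> norm x \<le> R" using bdd by (auto simp: bounded_iff)
  have sub: "T k \<subseteq> cball 0 (R + d * norm e)" for k
  proof
    fix z assume "z \<in> T k"
    then obtain x where x: "x \<in> E" "z = (d / real (Suc k)) *\<^sub>R e + x" by (auto simp: T_def)
    have "norm z \<le> d / real (Suc k) * norm e + norm x"
      using norm_triangle_ineq[of "(d / real (Suc k)) *\<^sub>R e" x] d x by simp
    also have "\<dots> \<le> d * norm e + R"
      using d R[OF x(1)] by (intro add_mono mult_right_mono) (auto simp: divide_le_eq)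
    finally show "z \<in> cball 0 (R + d * norm e)" by (simp add: algebra_simps)
  qed
  let ?C = "measure lebesgue (cball (0::'a) (R + d * norm e))"
  have bound: "real N * measure lebesgue E \<le> ?C" for N
  proof -
    have "negligible (T i \<inter> T j)" if "i \<noteq> j" for i j
      using disj[of i j] disj[of j i] that by (cases i j rule: linorder_cases) (auto simp: disjnt_def Int_commute)
    then have "measure lebesgue (\<Union> (T ` {..<N})) = (\<Sum>i<N. measure lebesgue (T i))"
      using T by (intro measure_negligible_finite_Union_image) (auto simp: pairwise_def)
    moreover have "measure lebesgue (\<Union> (T ` {..<N})) \<le> ?C"
      using sub T by (intro measure_mono_fmeasurable) (auto intro!: fmeasurableD)
    ultimately show ?thesis using T by simp
  qed
  have "measure lebesgue E = 0"
  proof (rule ccontr)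
    assume "measure lebesgue E \<noteq> 0"
    then have "measure lebesgue E > 0" by (simp add: zero_less_measure_iff)
    then obtain N where "real N * measure lebesgue E > ?C" using reals_Archimedean3 by blast
    then show False using bound[of N] by simp
  qed
  then show ?thesis using meas by (simp add: negligible_iff_measure)
qed

text \<open>Local and with a first-order error term, because a utility is supported from below by
  the curved functions \<open>b _ y\<close> rather than by affine ones.\<close>

definition frechet_subgradient :: "'a::real_inner set \<Rightarrow> ('a \<Rightarrow> real) \<Rightarrow> 'a \<Rightarrow> 'a \<Rightarrow> bool" where
  "frechet_subgradient S u x p \<longleftrightarrow>
     (\<forall>e>0. \<exists>d>0. \<forall>z\<in>S. norm (z - x) < d \<longrightarrow> u x + inner p (z - x) - e * norm (z - x) \<le> u z)"

text \<open>Distinct subgradients differ in some coordinate \<open>i\<close>, and a rational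
  \<open>r\<close> between the two values puts the point into a set \<open>E i r n\<close>. There
  are countably many such sets, so it suffices that each is null.\<close>

lemma negligible_two_frechet_subgradients:
  fixes S :: "'a::euclidean_space set"
  assumes S: "open S" "bounded S" and u: "continuous_on S u"
  shows "negligible {x \<in> S. \<exists>p q. p \<noteq> q \<and> frechet_subgradient S u x p \<and> frechet_subgradient S u x q}"
    (is "negligible ?N")
proof -
  \<comment> \<open>If \<open>p \<bullet> i < r < q \<bullet> i\<close>, then \<open>s \<mapsto> u (x + s *\<^sub>R i) - r * s\<close> has a strict local minimum at 0, of
    quantified sharpness \<open>1 / Suc n\<close>; such points are \<open>1 / Suc n\<close>-separated in direction \<open>i\<close>.\<close>
  define E where "E i r n = {x \<in> S. \<forall>s. \<bar>s\<bar> \<le> 1 / real (Suc n) \<and> x + s *\<^sub>R i \<in> S \<longrightarrow>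
      u x + r * s + \<bar>s\<bar> / real (Suc n) \<le> u (x + s *\<^sub>R i)}" for i :: 'a and r n
  have ED: "u x + r * s + \<bar>s\<bar> / real (Suc n) \<le> u (x + s *\<^sub>R i)"
    if "x \<in> E i r n" "\<bar>s\<bar> \<le> 1 / real (Suc n)" "x + s *\<^sub>R i \<in> S" for i r n x s
    using that by (simp only: E_def mem_Collect_eq)
  have ES: "E i r n \<subseteq> S" for i r n by (auto simp: E_def)
  have negl: "negligible (E i r n)" for i r n
  proof (rule negligible_if_disjoint_translates[where d = "1 / real (Suc n)" and e = i])
    \<comment> \<open>\<open>V s\<close> collects the points that violate the defining inequality at
      shift \<open>s\<close>. It is open by continuity of \<open>u\<close>, which makes
      \<open>E i r n\<close> an open set minus an open set, hence measurable.\<close>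
    define V where "V s = {x \<in> S \<inter> (\<lambda>x. x + s *\<^sub>R i) -` S.
        u (x + s *\<^sub>R i) - u x \<in> {..< r * s + \<bar>s\<bar> / real (Suc n)}}" for s
    have "open (V s)" for s
    proof -
      have op: "open (S \<inter> (\<lambda>x. x + s *\<^sub>R i) -` S)"
        by (intro open_Int S open_vimage continuous_intros)
      have "continuous_on (S \<inter> (\<lambda>x. x + s *\<^sub>R i) -` S) (\<lambda>x. u (x + s *\<^sub>R i) - u x)"
        by (intro continuous_intros continuous_on_compose2[OF u] continuous_on_subset[OF u]) auto
      from continuous_open_preimage[OF this op open_lessThan]
      show ?thesis by (auto simp: V_def vimage_def Int_def elim!: back_subst[where P = "open"])
    qed
    moreover have "E i r n = S - (\<Union>s\<in>{s. \<bar>s\<bar> \<le> 1 / real (Suc n)}. V s)"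
      unfolding E_def V_def by (fastforce simp: not_less)
    ultimately have "E i r n \<in> sets lebesgue"
      using S(1) by (metis (no_types, lifting) borel_open open_UN sets.Diff sets_completionI_sets sets_lborel)
    moreover show bd: "bounded (E i r n)" using S(2) by (rule bounded_subset) (auto simp: E_def)
    ultimately show "E i r n \<in> lmeasurable" using bounded_set_imp_lmeasurable by blast
    show "0 < 1 / real (Suc n)" by simp
    fix x and s :: real assume x: "x \<in> E i r n" and s: "0 < s" "s \<le> 1 / real (Suc n)"
    show "x + s *\<^sub>R i \<notin> E i r n"
    \<comment> \<open>Adding the inequality at \<open>x\<close> with shift \<open>s\<close> to the
      one at \<open>x + s *\<^sub>R i\<close> with shift \<open>- s\<close> cancels all terms in
      \<open>u\<close> and \<open>r\<close> and leaves a positive number that is at most 0.\<close>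
    proof
      assume y: "x + s *\<^sub>R i \<in> E i r n"
      have "u x + r * s + \<bar>s\<bar> / real (Suc n) \<le> u (x + s *\<^sub>R i)"
        using y ES s by (intro ED[OF x]) auto
      moreover have "u (x + s *\<^sub>R i) + r * (- s) + \<bar>- s\<bar> / real (Suc n) \<le> u (x + s *\<^sub>R i + (- s) *\<^sub>R i)"
        using x ES s by (intro ED[OF y]) auto
      moreover have "\<bar>s\<bar> / real (Suc n) > 0" using s by simp
      ultimately show False by simp
    qed
  qed
  have "?N \<subseteq> (\<Union>i\<in>Basis. \<Union>r\<in>\<rat>. \<Union>n. E i r n)"
  proof
    fix x assume "x \<in> ?N"
    then obtain p q where x: "x \<in> S" and "p \<noteq> q" and
      pq: "frechet_subgradient S u x p" "frechet_subgradient S u x q" by blast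
    then obtain i where i: "i \<in> Basis" "p \<bullet> i \<noteq> q \<bullet> i" using euclidean_eqI by blast
    obtain p q where pq: "frechet_subgradient S u x p" "frechet_subgradient S u x q" and lt: "p \<bullet> i < q \<bullet> i"
      using pq i(2) by (meson linorder_neqE_linordered_idom)
    obtain r where r: "r \<in> \<rat>" "p \<bullet> i < r" "r < q \<bullet> i" using Rats_dense_in_real[OF lt] by blast
    \<comment> \<open>Then \<open>p \<bullet> i \<le> r - 2 * e\<close> and
      \<open>r + 2 * e \<le> q \<bullet> i\<close>: one \<open>e\<close> pays for the subgradient
      error, the other for the sharpness \<open>1 / Suc n\<close>.\<close>
    define e where "e = min (r - p \<bullet> i) (q \<bullet> i - r) / 2"
    have e: "e > 0" using r by (simp add: e_def)
    obtain d1 where d1: "d1 > 0"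
      "\<And>z. z \<in> S \<Longrightarrow> norm (z - x) < d1 \<Longrightarrow> u x + inner p (z - x) - e * norm (z - x) \<le> u z"
      using pq(1) e unfolding frechet_subgradient_def by blast
    obtain d2 where d2: "d2 > 0"
      "\<And>z. z \<in> S \<Longrightarrow> norm (z - x) < d2 \<Longrightarrow> u x + inner q (z - x) - e * norm (z - x) \<le> u z"
      using pq(2) e unfolding frechet_subgradient_def by blast
    obtain n where n: "1 / real (Suc n) < min e (min d1 d2)"
      using nat_approx_posE[of "min e (min d1 d2)"] e d1 d2 by (auto simp: divide_inverse)
    have "x \<in> E i r n"
      unfolding E_def
    proof (intro CollectI conjI x allI impI)
      fix s assume s: "\<bar>s\<bar> \<le> 1 / real (Suc n) \<and> x + s *\<^sub>R i \<in> S"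
      have "\<bar>s\<bar> / real (Suc n) = (1 / real (Suc n)) * \<bar>s\<bar>" by simp
      also have "\<dots> \<le> e * \<bar>s\<bar>" using n by (intro mult_right_mono) auto
      finally have se: "\<bar>s\<bar> / real (Suc n) \<le> e * \<bar>s\<bar>" .
      have near: "norm (x + s *\<^sub>R i - x) < d1" "norm (x + s *\<^sub>R i - x) < d2"
        using s n i(1) by auto
      have 1: "u x + (p \<bullet> i) * s - e * \<bar>s\<bar> \<le> u (x + s *\<^sub>R i)"
        and 2: "u x + (q \<bullet> i) * s - e * \<bar>s\<bar> \<le> u (x + s *\<^sub>R i)"
        using d1(2)[OF _ near(1)] d2(2)[OF _ near(2)] s i(1) by (auto simp: mult.commute)
      show "u x + r * s + \<bar>s\<bar> / real (Suc n) \<le> u (x + s *\<^sub>R i)"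
      \<comment> \<open>The larger slope \<open>q \<bullet> i\<close> controls forward shifts, the
        smaller slope \<open>p \<bullet> i\<close> backward ones.\<close>
      proof (cases "s \<ge> 0")
        case True
        have "(r + 2 * e) * s \<le> (q \<bullet> i) * s" using True by (intro mult_right_mono) (auto simp: e_def)
        then show ?thesis using 2 se True by (simp add: algebra_simps)
      next
        case False
        have "(r - 2 * e) * s \<le> (p \<bullet> i) * s" using False by (intro mult_right_mono_neg) (auto simp: e_def)
        then show ?thesis using 1 se False by (simp add: algebra_simps)
      qed
    qed
    then show "x \<in> (\<Union>i\<in>Basis. \<Union>r\<in>\<rat>. \<Union>n. E i r n)" using i(1) r(1) by blast
  qed
  moreover have "negligible (\<Union>n. E i r n)" for i r
    by (intro negligible_countable_Union) (auto intro: negl)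
  then have "negligible (\<Union>r\<in>\<rat>. \<Union>n. E i r n)" for i
    by (intro negligible_countable_Union countable_image countable_rat) auto
  then have "negligible (\<Union>i\<in>Basis. \<Union>r\<in>\<rat>. \<Union>n. E i r n)"
    by (intro negligible_countable_Union countable_image countable_finite finite_Basis) auto
  ultimately show ?thesis using negligible_subset by blast
qed

section \<open>Derivatives of the preference function\<close>

text \<open>Since \<open>gradient\<close> is a definite description, existence and uniqueness are
  needed before it can be computed; \<open>D\<close> is the Riesz vector of
  \<open>L\<close>.\<close>

lemma has_derivative_imp_GDERIV_gradient:
  fixes f :: "'a::euclidean_space \<Rightarrow> real"
  assumes f: "(f has_derivative L) (at x)"
  shows "GDERIV f x :> gradient f x" and "inner h (gradient f x) = L h"
proof -
  define D where "D = (\<Sum>i\<in>Basis. L i *\<^sub>R i)"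
  have lin: "linear L" using f has_derivative_linear by blast
  have D: "inner h D = L h" for h
  proof -
    have "L h = L (\<Sum>i\<in>Basis. (h \<bullet> i) *\<^sub>R i)" by (simp add: euclidean_representation)
    also have "\<dots> = (\<Sum>i\<in>Basis. (h \<bullet> i) * L i)"
      using lin by (simp add: linear_sum linear_cmul)
    finally show ?thesis by (simp add: D_def inner_sum_right mult.commute)
  qed
  have "GDERIV f x :> D" using f D by (simp add: gderiv_def)
  moreover have "D' = D" if "GDERIV f x :> D'" for D'
  proof -
    have "(\<lambda>h. inner h D') = L"
      using that f has_derivative_unique unfolding gderiv_def by blast
    then show ?thesis using D by (metis vector_eq_ldot)
  qed
  ultimately have "gradient f x = D" unfolding gradient_def by blast
  then show "GDERIV f x :> gradient f x" "inner h (gradient f x) = L h"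
    using \<open>GDERIV f x :> D\<close> D by simp_all
qed

lemma D_x_properties:
  assumes "((\<lambda>(x, y). b x y) has_derivative L) (at (x, y))"
  shows GDERIV_D_x: "GDERIV (\<lambda>x'. b x' y) x :> D_x b x y"
    and D_x_nth: "D_x b x y $ i = L (axis i 1, 0)"
proof -
  have "((\<lambda>x'. (x', y)) has_derivative (\<lambda>h. (h, 0))) (at x)"
    by (auto intro!: derivative_eq_intros)
  from has_derivative_compose[OF this assms]
  have *: "((\<lambda>x'. b x' y) has_derivative (\<lambda>h. L (h, 0))) (at x)" by simp
  show "GDERIV (\<lambda>x'. b x' y) x :> D_x b x y"
    using has_derivative_imp_GDERIV_gradient(1)[OF *] by (simp add: D_x_def)
  show "D_x b x y $ i = L (axis i 1, 0)"
    using has_derivative_imp_GDERIV_gradient(2)[OF *, of "axis i 1"] by (simp add: D_x_def inner_axis')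
qed

lemma D_y_nth:
  assumes "((\<lambda>(x, y). b x y) has_derivative L) (at (x, y))"
  shows "D_y b x y $ j = L (0, axis j 1)"
proof -
  have "((\<lambda>y'. (x, y')) has_derivative (\<lambda>h. (0, h))) (at y)"
    by (auto intro!: derivative_eq_intros)
  from has_derivative_compose[OF this assms]
  have *: "((\<lambda>y'. b x y') has_derivative (\<lambda>h. L (0, h))) (at y)" by simp
  show ?thesis
    using has_derivative_imp_GDERIV_gradient(2)[OF *, of "axis j 1"] by (simp add: D_y_def inner_axis')
qed

lemma has_derivative_vec_iff:
  fixes f :: "'a::real_normed_vector \<Rightarrow> real^'n"
  shows "(f has_derivative f') (at x within S) \<longleftrightarrow>
    (\<forall>i. ((\<lambda>x. f x $ i) has_derivative (\<lambda>h. f' h $ i)) (at x within S))"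
  by (subst has_derivative_componentwise_within) (auto simp: Basis_vec_def inner_axis)

text \<open>\<open>D2_xy\<close> differentiates first in x and then in y; differentiating
  \<open>D_y\<close> in x takes the opposite order, so symmetry of second derivatives makes the two
  matrices transposes of each other.\<close>

lemma D_y_has_derivative:
  fixes b :: "real^'m \<Rightarrow> real^'n \<Rightarrow> real"
  assumes U: "open U" "(x, y) \<in> U" and C2: "C_diff_on (Suc (Suc k)) U (\<lambda>(x, y). b x y)"
  shows "((\<lambda>x'. D_y b x' y) has_derivative (\<lambda>h. transpose (D2_xy b x y) *v h)) (at x)"
proof -
  define f where "f = (\<lambda>(x, y). b x y)"
  define f' where "f' q = frechet_derivative f (at q)" for q
  define G where "G e = frechet_derivative (\<lambda>q. f' q e) (at (x, y))" for e
  have f: "(f has_derivative f' q) (at q)" if "q \<in> U" for q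
    using C2 that by (auto simp: f_def f'_def frechet_derivative_works)
  have G: "((\<lambda>q. f' q e) has_derivative G e) (at (x, y))" if "e \<in> Basis" for e
    using C2 that U(2) by (auto simp: f_def f'_def G_def frechet_derivative_works)
  have ax: "(axis i 1 :: real^'m, 0 :: real^'n) \<in> Basis" for i
    by (auto simp: Basis_prod_def)
  have ay: "(0 :: real^'m, axis j 1 :: real^'n) \<in> Basis" for j
    by (auto simp: Basis_prod_def)
  have sym: "G (axis i 1, 0) (0, axis j 1) = G (0, axis j 1) (axis i 1, 0)" for i j
    using second_derivative_symmetric[OF U f G[OF ax] G[OF ay]] by simp
  define N where "N h = (\<chi> j. G (0, axis j 1) (h, 0))" for h
  define M where "M h = (\<chi> i. G (axis i 1, 0) (0, h))" for h
  have N: "((\<lambda>x'. D_y b x' y) has_derivative N) (at x)"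
    unfolding has_derivative_vec_iff
  proof
    fix j
    have "((\<lambda>x'. (x', y)) has_derivative (\<lambda>h. (h, 0))) (at x)"
      by (auto intro!: derivative_eq_intros)
    from has_derivative_compose[OF this G[OF ay]]
    have *: "((\<lambda>x'. f' (x', y) (0, axis j 1)) has_derivative (\<lambda>h. N h $ j)) (at x)"
      by (simp add: N_def)
    \<comment> \<open>\<open>D_y\<close> is known to agree with the components of \<open>f'\<close>
      only where \<open>b\<close> is differentiable, so the derivative is transferred on the open
      slice of \<open>U\<close>.\<close>
    show "((\<lambda>x'. D_y b x' y $ j) has_derivative (\<lambda>h. N h $ j)) (at x)"
    proof (rule has_derivative_transform_within_open[OF *])
      show "open ((\<lambda>x'. (x', y)) -` U)" by (intro open_vimage U continuous_intros)
      show "x \<in> (\<lambda>x'. (x', y)) -` U" using U by simp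
    qed (use D_y_nth[OF f[unfolded f_def]] in auto)
  qed
  have M: "((\<lambda>y'. D_x b x y') has_derivative M) (at y)"
    unfolding has_derivative_vec_iff
  proof
    fix i
    have "((\<lambda>y'. (x, y')) has_derivative (\<lambda>h. (0, h))) (at y)"
      by (auto intro!: derivative_eq_intros)
    from has_derivative_compose[OF this G[OF ax]]
    have *: "((\<lambda>y'. f' (x, y') (axis i 1, 0)) has_derivative (\<lambda>h. M h $ i)) (at y)"
      by (simp add: M_def)
    show "((\<lambda>y'. D_x b x y' $ i) has_derivative (\<lambda>h. M h $ i)) (at y)"
    proof (rule has_derivative_transform_within_open[OF *])
      show "open ((\<lambda>y'. (x, y')) -` U)" by (intro open_vimage U continuous_intros)
      show "y \<in> (\<lambda>y'. (x, y')) -` U" using U by simp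
    qed (use D_x_nth[OF f[unfolded f_def]] in auto)
  qed
  have "D2_xy b x y = matrix M"
    unfolding D2_xy_def jacobian_def using frechet_derivative_at[OF M] by simp
  then have "transpose (D2_xy b x y) = matrix N"
    by (simp add: vec_eq_iff transpose_def matrix_def M_def N_def sym)
  moreover have "linear N" using N has_derivative_linear by blast
  ultimately show ?thesis using N by (simp add: matrix_works)
qed

text \<open>The difference \<open>b _ y - b _ y'\<close> has zero gradient on the closure of X.
  Injectivity of the derivative of \<open>D_y b _ y\<close>, b-convexity and connected level sets
  supply the paths along which it is constant.\<close>

lemma preference_difference_constant:
  fixes b :: "real^'m \<Rightarrow> real^'n \<Rightarrow> real"
  assumes "bounded X"
    and U: "open U" "closure X \<times> closure Y \<subseteq> U" and C2: "C_diff_on (Suc (Suc k)) U (\<lambda>(x, y). b x y)"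
    and conn: "\<And>q. connected {x \<in> closure X. D_y b x y = q}"
    and rank: "\<And>x. x \<in> closure X \<Longrightarrow> rank (D2_xy b x y) = CARD('m)"
    and conv: "b_convex X Y b"
    and y: "y \<in> closure Y" "y' \<in> closure Y"
    and eq: "\<And>x. x \<in> closure X \<Longrightarrow> D_x b x y = D_x b x y'"
    and x: "x \<in> closure X" "z \<in> closure X"
  shows "b x y - b x y' = b z y - b z y'"
proof (rule constant_if_zero_derivative_reparametrized[where K = "closure X" and F = "\<lambda>x. D_y b x y"])
  show "compact (closure X)" using \<open>bounded X\<close> by simp
  show "convex ((\<lambda>x. D_y b x y) ` closure X)" using conv y by (simp add: b_convex_def)
  fix x assume x: "x \<in> closure X"
  have inU: "(x, y) \<in> U" "(x, y') \<in> U" using x y U by auto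
  show "((\<lambda>x. D_y b x y) has_derivative (\<lambda>h. transpose (D2_xy b x y) *v h)) (at x within closure X)"
    using D_y_has_derivative[OF U(1) inU(1) C2] by (rule has_derivative_at_withinI)
  show "inj ((*v) (transpose (D2_xy b x y)))"
    using rank[OF x] by (simp add: full_rank_injective[symmetric] rank_transpose)
  have der: "GDERIV (\<lambda>x. b x w) x :> D_x b x w" if "(x, w) \<in> U" for w
    using C2 that by (auto intro!: GDERIV_D_x simp: frechet_derivative_works)
  have "GDERIV (\<lambda>x. b x y - b x y') x :> 0"
    using GDERIV_diff[OF der[OF inU(1)] der[OF inU(2)]] eq[OF x] by simp
  then show "((\<lambda>x. b x y - b x y') has_derivative (\<lambda>_. 0)) (at x within closure X)"
    by (auto simp: gderiv_def intro: has_derivative_at_withinI)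
qed (use conn x in auto)

section \<open>Maximizers and utilities\<close>

lemma optimal_goodsD:
  assumes y: "y \<in> optimal_goods Y b w x" and u: "utility Y b w x = ereal r"
  shows "y \<in> closure Y" and "w y = ereal (b x y - r)"
proof -
  show Y: "y \<in> closure Y" using y by (simp add: optimal_goods_def is_arg_max_def)
  have "utility Y b w x = ereal (b x y) - w y"
    unfolding utility_def
  proof (rule antisym)
    show "(SUP y\<in>closure Y. ereal (b x y) - w y) \<le> ereal (b x y) - w y"
      using y by (intro SUP_least) (auto simp: optimal_goods_def is_arg_max_linorder)
    show "ereal (b x y) - w y \<le> (SUP y\<in>closure Y. ereal (b x y) - w y)"
      using Y by (rule SUP_upper)
  qed
  then show "w y = ereal (b x y - r)" using u by (cases "w y") auto
qed

text \<open>The agent \<open>z\<close> may also buy the good that is optimal for \<open>x\<close>,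
  whose price optimality fixes as \<open>b x y - u x\<close>.\<close>

lemma optimal_goods_support:
  assumes y: "y \<in> optimal_goods Y b w x"
    and u: "utility Y b w x = ereal (u x)" "utility Y b w z = ereal (u z)"
  shows "u x + (b z y - b x y) \<le> u z"
proof -
  have "ereal (b z y) - w y \<le> ereal (u z)"
    unfolding u(2)[symmetric] utility_def using optimal_goodsD(1)[OF y u(1)] by (rule SUP_upper)
  then show ?thesis using optimal_goodsD(2)[OF y u(1)] by simp
qed

lemma frechet_subgradient_if_supported:
  assumes der: "GDERIV f x :> p" and sup: "\<And>z. z \<in> S \<Longrightarrow> u x + (f z - f x) \<le> u z"
  shows "frechet_subgradient S u x p"
  unfolding frechet_subgradient_def
proof (intro allI impI)
  fix e :: real assume "e > 0"
  then obtain d where d: "d > 0"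
    "\<And>z. norm (z - x) < d \<Longrightarrow> norm (f z - f x - inner (z - x) p) \<le> e * norm (z - x)"
    using der unfolding gderiv_def has_derivative_at_alt by blast
  have "u x + inner p (z - x) - e * norm (z - x) \<le> u z" if "z \<in> S" "norm (z - x) < d" for z
    using sup[OF that(1)] d(2)[OF that(2)] by (simp add: abs_le_iff inner_commute)
  then show "\<exists>d>0. \<forall>z\<in>S. norm (z - x) < d \<longrightarrow> u x + inner p (z - x) - e * norm (z - x) \<le> u z"
    using d(1) by blast
qed

text \<open>A supremum of equicontinuous functions: \<open>b\<close> is uniformly continuous on the
  compact product, and \<open>v\<close> only adds constants in x. The bound \<open>e / 2\<close> is
  used because the supremum preserves only the weak inequality.\<close>

lemma continuous_on_utility:
  fixes b :: "real^'m \<Rightarrow> real^'n \<Rightarrow> real"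
  assumes bdd: "bounded X" "bounded Y"
    and b: "continuous_on (closure X \<times> closure Y) (\<lambda>(x, y). b x y)"
    and u: "\<And>x. x \<in> closure X \<Longrightarrow> utility Y b v x = ereal (u x)"
  shows "continuous_on (closure X) u"
  unfolding continuous_on_iff
proof (intro ballI allI impI)
  fix x and e :: real assume x: "x \<in> closure X" and e: "e > 0"
  have "uniformly_continuous_on (closure X \<times> closure Y) (\<lambda>(x, y). b x y)"
    using b bdd by (intro compact_uniformly_continuous compact_Times) auto
  then obtain d where d: "d > 0"
    "\<And>p q. p \<in> closure X \<times> closure Y \<Longrightarrow> q \<in> closure X \<times> closure Y \<Longrightarrow> dist p q < d \<Longrightarrow>
      dist (case p of (x, y) \<Rightarrow> b x y) (case q of (x, y) \<Rightarrow> b x y) < e / 2"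
    unfolding uniformly_continuous_on_def using half_gt_zero[OF e] by metis
  have le: "u x \<le> u z + e / 2" if xz: "x \<in> closure X" "z \<in> closure X" "dist x z < d" for x z
  proof -
    have "utility Y b v x \<le> ereal (u z + e / 2)"
      unfolding utility_def
    proof (rule SUP_least)
      fix y assume y: "y \<in> closure Y"
      have "dist (b x y) (b z y) < e / 2"
        using d(2)[of "(x, y)" "(z, y)"] xz y by (simp add: dist_Pair_Pair)
      then have 1: "b x y \<le> b z y + e / 2" unfolding dist_real_def by linarith
      have 2: "ereal (b z y) - v y \<le> ereal (u z)"
        unfolding u[OF xz(2), symmetric] utility_def using y by (rule SUP_upper)
      show "ereal (b x y) - v y \<le> ereal (u z + e / 2)"
        using 1 2 by (cases "v y") auto
    qed
    then show ?thesis using u[OF xz(1)] by simp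
  qed
  show "\<exists>d>0. \<forall>z\<in>closure X. dist z x < d \<longrightarrow> dist (u z) (u x) < e"
  proof (intro exI[of _ d] conjI ballI impI d)
    fix z assume "z \<in> closure X" "dist z x < d"
    then show "dist (u z) (u x) < e"
      using le[of x z] le[of z x] x e by (simp add: dist_real_def dist_commute abs_less_iff)
  qed
qed

text \<open>Both schedules have the same utility \<open>u\<close>, so optimal goods of either one
  give subgradients of one function, and these coincide off a null set.\<close>

lemma AE_maximizers_same_D_x:
  fixes X :: "(real^'m) set" and b :: "real^'m \<Rightarrow> real^'n \<Rightarrow> real"
  assumes X: "open X" "bounded X" and "bounded Y"
    and b: "\<And>p. p \<in> closure X \<times> closure Y \<Longrightarrow> (\<lambda>(x, y). b x y) differentiable (at p)"
    and u: "\<And>x. x \<in> closure X \<Longrightarrow> utility Y b v x = ereal (u x)"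
           "\<And>x. x \<in> closure X \<Longrightarrow> utility Y b w x = ereal (u x)"
  shows "AE x in lebesgue_on X. \<forall>y\<in>optimal_goods Y b v x. \<forall>y'\<in>optimal_goods Y b w x.
           D_x b x y = D_x b x y'"
proof -
  let ?N = "{x \<in> X. \<exists>p q. p \<noteq> q \<and> frechet_subgradient X u x p \<and> frechet_subgradient X u x q}"
  have XX: "x \<in> closure X" if "x \<in> X" for x using that closure_subset by blast
  have sub: "frechet_subgradient X u x (D_x b x y)"
    if x: "x \<in> X" and y: "y \<in> optimal_goods Y b v' x"
      and u: "\<And>x. x \<in> closure X \<Longrightarrow> utility Y b v' x = ereal (u x)" for x y v'
  proof (rule frechet_subgradient_if_supported)
    have "y \<in> closure Y" using optimal_goodsD(1)[OF y u] XX x by blast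
    then show "GDERIV (\<lambda>x. b x y) x :> D_x b x y"
      using b XX x by (auto intro!: GDERIV_D_x simp: frechet_derivative_works)
    show "u x + (b z y - b x y) \<le> u z" if "z \<in> X" for z
      using optimal_goods_support[OF y] u XX x that by blast
  qed
  have "continuous_on (closure X \<times> closure Y) (\<lambda>(x, y). b x y)"
    using b by (meson continuous_at_imp_continuous_on differentiable_imp_continuous_within)
  then have "continuous_on X u"
    using continuous_on_utility[OF X(2) \<open>bounded Y\<close> _ u(1)] continuous_on_subset closure_subset by blast
  then have "?N \<in> null_sets lebesgue"
    using negligible_two_frechet_subgradients[OF X] negligible_iff_null_sets by blast
  then have "AE x in lebesgue. x \<notin> ?N" by (rule AE_not_in)
  then have "AE x in lebesgue. x \<in> X \<longrightarrow> (\<forall>y\<in>optimal_goods Y b v x. \<forall>y'\<in>optimal_goods Y b w x.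
           D_x b x y = D_x b x y')"
  proof (rule AE_mp, intro AE_I2 impI ballI)
    fix x y y' assume "x \<notin> ?N" "x \<in> X" "y \<in> optimal_goods Y b v x" "y' \<in> optimal_goods Y b w x"
    then show "D_x b x y = D_x b x y'" using sub u by blast
  qed
  then show ?thesis
    using X(1) by (subst AE_restrict_space_iff) auto
qed

section \<open>Cheapest goods in a fibre and the comparison of the two schedules\<close>

lemma mem_M_set_iff:
  "y \<in> M_set Y b c x0 w \<longleftrightarrow> y \<in> closure Y \<and> Q_map b x0 y = w \<and>
     (\<forall>y'\<in>closure Y. Q_map b x0 y' = w \<longrightarrow> c y - b x0 y \<le> c y' - b x0 y')"
  by (auto simp: M_set_def Q_fiber_def is_arg_min_linorder)

lemma eff_cost_eq:
  assumes "y \<in> M_set Y b c x0 w"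
  shows "eff_cost Y b c x0 w = c y - b x0 y"
  unfolding eff_cost_def
  using assms by (intro cInf_eq_minimum) (auto simp: mem_M_set_iff Q_fiber_def)

theorem proposition5p1:
  fixes X :: "(real^'m) set" and Y :: "(real^'n) set"
    and b :: "real^'m \<Rightarrow> real^'n \<Rightarrow> real"
    and c :: "real^'n \<Rightarrow> real"
    and v :: "real^'n \<Rightarrow> ereal"
    and x0 :: "real^'m"
  assumes dims: "CARD('n) > CARD('m)"
    and X: "X \<noteq> {}" "open X" "bounded X"
    and Y: "Y \<noteq> {}" "open Y" "bounded Y"
    and b_C4: "C_diff_closure 4 X Y b"
    and connected_x: "\<And>x p. x \<in> closure X \<Longrightarrow> connected {y \<in> closure Y. D_x b x y = p}"
    and connected_y: "\<And>y q. y \<in> closure Y \<Longrightarrow> connected {x \<in> closure X. D_y b x y = q}"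
    and full_rank: "\<And>x y. x \<in> closure X \<Longrightarrow> y \<in> closure Y \<Longrightarrow> rank (D2_xy b x y) = CARD('m)"
    and b_conv: "b_convex X Y b"
    and L_indep: "\<And>x x' y. x \<in> closure X \<Longrightarrow> x' \<in> closure X \<Longrightarrow> y \<in> closure Y
                    \<Longrightarrow> L_set Y b x y = L_set Y b x' y"
    and x0: "x0 \<in> X"
    and M_nonempty: "\<And>w. w \<in> W_set Y b x0 \<Longrightarrow> M_set Y b c x0 w \<noteq> {}"
    and v_price: "\<And>y. y \<in> closure Y \<Longrightarrow> v y \<noteq> -\<infinity>"
    and v_finite: "\<And>x. x \<in> closure X \<Longrightarrow> \<bar>utility Y b v x\<bar> \<noteq> \<infinity>"
  shows "(\<forall>x\<in>closure X. utility Y b (v_tilde X Y b c x0 v) x = utility Y b v x) \<and>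
    (AE x in lebesgue_on X.
      (\<forall>y\<in>optimal_goods Y b v x. \<forall>yt\<in>optimal_goods Y b (v_tilde X Y b c x0 v) x.
         v y - ereal (c y) \<le> v_tilde X Y b c x0 v yt - ereal (c yt)) \<and>
      (\<forall>yt\<in>optimal_goods Y b (v_tilde X Y b c x0 v) x.
         v_tilde X Y b c x0 v yt - ereal (c yt)
           = ereal (eff_pref Y b x0 x (Q_map b x0 yt)) - utility Y b v x
               - ereal (eff_cost Y b c x0 (Q_map b x0 yt)) \<and>
         ereal (eff_pref Y b x0 x (Q_map b x0 yt)) - utility Y b v x
               - ereal (eff_cost Y b c x0 (Q_map b x0 yt))
           = ereal (b x yt) - utility Y b v x - ereal (c yt)))"
proof -
  have "C_diff_closure (Suc (Suc 2)) X Y b" using b_C4 by simp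
  then obtain U where U: "open U" "closure X \<times> closure Y \<subseteq> U" and
    C2: "C_diff_on (Suc (Suc 2)) U (\<lambda>(x, y). b x y)"
    unfolding C_diff_closure_def by metis
  have diff: "(\<lambda>(x, y). b x y) differentiable (at p)" if "p \<in> closure X \<times> closure Y" for p
    using C2 subsetD[OF U(2) that] unfolding C_diff_on.simps by blast
  have XX: "x \<in> closure X" if "x \<in> X" for x using that closure_subset by blast
  define u where "u x = real_of_ereal (utility Y b v x)" for x
  have u: "utility Y b v x = ereal (u x)" if "x \<in> closure X" for x
    using v_finite[OF that] by (simp add: u_def ereal_real)
  \<comment> \<open>Independence of \<open>L_set\<close> from x carries equality of
    \<open>D_x b\<close> from one agent to all others; it is used both from \<open>x0\<close> and
    towards \<open>x0\<close>.\<close>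
  have D_x_eq: "D_x b x y = D_x b x y'"
    if "x \<in> closure X" "z \<in> closure X" "y \<in> closure Y" "y' \<in> closure Y" "D_x b z y = D_x b z y'"
    for x z y y'
  proof -
    have "y' \<in> L_set Y b z y" using that by (simp add: L_set_def)
    then have "y' \<in> L_set Y b x y" using L_indep[OF that(2,1,3)] by simp
    then show ?thesis by (simp add: L_set_def)
  qed
  have pref: "b x y - b x0 y = b x y' - b x0 y'"
    if x: "x \<in> closure X" and y: "y \<in> closure Y" "y' \<in> closure Y"
      and Q: "Q_map b x0 y = Q_map b x0 y'" for x y y'
  proof -
    have "b x y - b x y' = b x0 y - b x0 y'"
    proof (rule preference_difference_constant[OF X(3) U C2 _ _ b_conv y _ x XX[OF x0]])
      show "D_x b z y = D_x b z y'" if "z \<in> closure X" for z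
        using D_x_eq[OF that XX[OF x0] y] Q by (simp add: Q_map_def)
    qed (use connected_y[OF y(1)] full_rank y in auto)
    then show ?thesis by simp
  qed
  let ?vt = "v_tilde X Y b c x0 v"
  let ?vbb = "utility_transform X b (utility Y b v)"
  have vt_M: "?vt y = ?vbb y" if "y \<in> M_set Y b c x0 (Q_map b x0 y)" "y \<in> closure Y" for y
    using that unfolding v_tilde_def W_set_def by auto
  have M: "y \<in> M_set Y b c x0 (Q_map b x0 y)" if "?vt y \<noteq> \<infinity>" for y
    using that unfolding v_tilde_def by (auto simp: mem_M_set_iff split: if_splits)
  have vbb_ge: "ereal (b x y - u x) \<le> ?vbb y" if "x \<in> closure X" for x y
    unfolding utility_transform_def by (rule SUP_upper2[OF that]) (simp add: u that)
  have vbb_le: "?vbb y \<le> v y" if y: "y \<in> closure Y" for y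
    unfolding utility_transform_def
  proof (rule SUP_least)
    fix x assume x: "x \<in> closure X"
    have "ereal (b x y) - v y \<le> ereal (u x)"
      unfolding u[OF x, symmetric] utility_def using y by (rule SUP_upper)
    then show "ereal (b x y) - utility Y b v x \<le> v y"
      using v_price[OF y] by (cases "v y") (auto simp: u[OF x])
  qed
  \<comment> \<open>By \<open>pref\<close>, moving within a fibre changes every term of the supremum
    by the same amount, independent of x.\<close>
  have vbb_shift: "?vbb y' \<le> ?vbb y + ereal (b x0 y' - b x0 y)"
    if y: "y \<in> closure Y" "y' \<in> closure Y" "Q_map b x0 y = Q_map b x0 y'" for y y'
    unfolding utility_transform_def[of _ _ _ y']
  proof (rule SUP_least)
    fix x assume x: "x \<in> closure X"
    have "ereal (b x y') - utility Y b v x = ereal (b x y - u x) + ereal (b x0 y' - b x0 y)"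
      using pref[OF x y] by (simp add: u[OF x])
    also have "\<dots> \<le> ?vbb y + ereal (b x0 y' - b x0 y)"
      by (intro add_right_mono vbb_ge x)
    finally show "ereal (b x y') - utility Y b v x \<le> ?vbb y + ereal (b x0 y' - b x0 y)" .
  qed
  have ut: "utility Y b ?vt x = ereal (u x)" if x: "x \<in> closure X" for x
  proof (rule antisym)
    show "utility Y b ?vt x \<le> ereal (u x)"
      unfolding utility_def[of _ _ ?vt]
    proof (rule SUP_least)
      fix y assume y: "y \<in> closure Y"
      show "ereal (b x y) - ?vt y \<le> ereal (u x)"
      proof (cases "?vt y = \<infinity>")
        case False
        then show ?thesis using vbb_ge[OF x, of y] vt_M[OF M y] by (cases "?vbb y") auto
      qed simp
    qed
    \<comment> \<open>Each good \<open>y\<close> is replaced by a cheapest \<open>y'\<close> of its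
      fibre: its value to every agent changes by exactly \<open>b x0 y' - b x0 y\<close>, while the
      price \<open>?vt y'\<close> exceeds \<open>v y\<close> by at most this amount.\<close>
    have "utility Y b v x \<le> utility Y b ?vt x"
      unfolding utility_def[of _ _ v]
    proof (rule SUP_least)
      fix y assume y: "y \<in> closure Y"
      then obtain y' where y': "y' \<in> M_set Y b c x0 (Q_map b x0 y)"
        using M_nonempty[of "Q_map b x0 y"] by (auto simp: W_set_def)
      then have cl: "y' \<in> closure Y" and Q: "Q_map b x0 y = Q_map b x0 y'"
        by (auto simp: mem_M_set_iff)
      have "?vt y' \<le> ?vbb y + ereal (b x0 y' - b x0 y)"
        using vt_M[of y'] y' cl Q vbb_shift[OF y cl Q] by simp
      also have "\<dots> \<le> v y + ereal (b x0 y' - b x0 y)"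
        by (intro add_right_mono vbb_le y)
      finally have *: "?vt y' \<le> v y + ereal (b x0 y' - b x0 y)" .
      have "ereal (b x y) - v y \<le> ereal (b x y') - ?vt y'"
        using * pref[OF x y cl Q] v_price[OF y] by (cases "v y"; cases "?vt y'") auto
      also have "\<dots> \<le> utility Y b ?vt x"
        unfolding utility_def using cl by (rule SUP_upper)
      finally show "ereal (b x y) - v y \<le> utility Y b ?vt x" .
    qed
    then show "ereal (u x) \<le> utility Y b ?vt x" by (simp add: u[OF x])
  qed
  \<comment> \<open>Finite utility forces a finite price at the maximizer, and finite prices occur
    only on cheapest goods.\<close>
  have opt: "yt \<in> closure Y" "?vt yt = ereal (b x yt - u x)"
    "yt \<in> M_set Y b c x0 (Q_map b x0 yt)"
    if x: "x \<in> closure X" and yt: "yt \<in> optimal_goods Y b ?vt x" for x yt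
    using optimal_goodsD[OF yt ut[OF x]] M by auto
  have profit: "?vt yt - ereal (c yt)
        = ereal (eff_pref Y b x0 x (Q_map b x0 yt)) - utility Y b v x - ereal (eff_cost Y b c x0 (Q_map b x0 yt))
      \<and> ereal (eff_pref Y b x0 x (Q_map b x0 yt)) - utility Y b v x - ereal (eff_cost Y b c x0 (Q_map b x0 yt))
        = ereal (b x yt) - utility Y b v x - ereal (c yt)"
    if x: "x \<in> closure X" and yt: "yt \<in> optimal_goods Y b ?vt x" for x yt
  proof -
    have "eff_pref Y b x0 x (Q_map b x0 yt) = b x yt - b x0 yt"
      unfolding eff_pref_def
    proof (rule the_equality)
      show "\<forall>y\<in>Q_fiber Y b x0 (Q_map b x0 yt). b x y - b x0 y = b x yt - b x0 yt"
        using pref[OF x _ opt(1)[OF x yt]] by (simp add: Q_fiber_def)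
    qed (use opt(1)[OF x yt] in \<open>simp add: Q_fiber_def\<close>)
    then show ?thesis
      using opt(2)[OF x yt] eff_cost_eq[OF opt(3)[OF x yt]] by (simp add: u[OF x])
  qed
  \<comment> \<open>Both prices equal value minus \<open>u x\<close>, and \<open>pref\<close>
    removes the common effective preference. What remains is that \<open>yt\<close> minimizes
    \<open>c - b x0\<close> on the shared fibre.\<close>
  have compare: "v y - ereal (c y) \<le> ?vt yt - ereal (c yt)"
    if x: "x \<in> closure X" and y: "y \<in> optimal_goods Y b v x" and yt: "yt \<in> optimal_goods Y b ?vt x"
      and eq: "D_x b x y = D_x b x yt" for x y yt
  proof -
    have cl: "y \<in> closure Y" and vy: "v y = ereal (b x y - u x)"
      using optimal_goodsD[OF y u[OF x]] by auto
    have Q: "Q_map b x0 y = Q_map b x0 yt"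
      unfolding Q_map_def using D_x_eq[OF XX[OF x0] x cl opt(1)[OF x yt] eq] .
    have "c yt - b x0 yt \<le> c y - b x0 y"
      using opt(3)[OF x yt] cl Q by (simp add: mem_M_set_iff)
    then show ?thesis
      using pref[OF x cl opt(1)[OF x yt] Q] by (simp add: vy opt(2)[OF x yt])
  qed
  have "AE x in lebesgue_on X. \<forall>y\<in>optimal_goods Y b v x. \<forall>yt\<in>optimal_goods Y b ?vt x.
      D_x b x y = D_x b x yt"
    using AE_maximizers_same_D_x[OF X(2,3) Y(3) diff u ut] .
  then have "AE x in lebesgue_on X.
      (\<forall>y\<in>optimal_goods Y b v x. \<forall>yt\<in>optimal_goods Y b ?vt x.
         v y - ereal (c y) \<le> ?vt yt - ereal (c yt)) \<and>
      (\<forall>yt\<in>optimal_goods Y b ?vt x.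
         ?vt yt - ereal (c yt)
           = ereal (eff_pref Y b x0 x (Q_map b x0 yt)) - utility Y b v x
               - ereal (eff_cost Y b c x0 (Q_map b x0 yt)) \<and>
         ereal (eff_pref Y b x0 x (Q_map b x0 yt)) - utility Y b v x
               - ereal (eff_cost Y b c x0 (Q_map b x0 yt))
           = ereal (b x yt) - utility Y b v x - ereal (c yt))"
  proof (rule AE_mp, intro AE_I2 impI)
    fix x
    assume "x \<in> space (lebesgue_on X)"
    then have x: "x \<in> closure X" using XX by (simp add: space_restrict_space)
    assume "\<forall>y\<in>optimal_goods Y b v x. \<forall>yt\<in>optimal_goods Y b ?vt x. D_x b x y = D_x b x yt"
    then show "(\<forall>y\<in>optimal_goods Y b v x. \<forall>yt\<in>optimal_goods Y b ?vt x.
         v y - ereal (c y) \<le> ?vt yt - ereal (c yt)) \<and>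
      (\<forall>yt\<in>optimal_goods Y b ?vt x.
         ?vt yt - ereal (c yt)
           = ereal (eff_pref Y b x0 x (Q_map b x0 yt)) - utility Y b v x
               - ereal (eff_cost Y b c x0 (Q_map b x0 yt)) \<and>
         ereal (eff_pref Y b x0 x (Q_map b x0 yt)) - utility Y b v x
               - ereal (eff_cost Y b c x0 (Q_map b x0 yt))
           = ereal (b x yt) - utility Y b v x - ereal (c yt))"
      using compare[OF x] profit[OF x] by blast
  qed
  then show ?thesis using u ut by simp
qed

end
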